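(* Let $V$ be a pure odd real vector space of dimension $m>4$ with a positive definite bilinear form $(\,,)$ that is symmetric in the ordinary sense, and let $\xi_1,\ldots,\xi_m$ be an orthonormal basis of $V$. Let $$v=a_1\xi_1\xi_2+a_2\xi_3\xi_4+\cdots+a_k\xi_{2k-1}\xi_{2k}\in S^2V,\qquad a_j\in\mathbb R,$$ with $0\le a_k\le a_{k-1}\le\cdots\le a_1$ if $m=2k+1$, and $|a_k|\le a_{k-1}\le\cdots\le a_1$ if $m=2k$. Then the invariant $(m-3)$-ary algebra $(V,\mu_v)$ with derived potential $\mu_v=*(v)$ is simple except in the following two cases, in which it is not simple: (1) $v=0$; (2) $v=a_1\xi_1\xi_2$ with $a_1\ne0$.
   Context: Since $V$ is pure odd, $S^pV$ is the ordinary exterior power $\bigwedge^pV$, with elements of parity $p\bmod2$, and $S^*V=\bigoplus_pS^pV$, $S^0V=\mathbb R$. The Poisson bracket $[\,,]$ on $S^*V$ is the bilinear operation, zero when one argument is a scalar, determined by $[x,y]=(x,y)$ for $x,y\in V$, $[v,w_1w_2]=[v,w_1]w_2+(-1)^{pq}w_1[v,w_2]$ for $v\in S^pV$, $w_1\in S^qV$, and $[v,w]=-(-1)^{pq}[w,v]$ for $v\in S^pV$, $w\in S^qV$. The $n$-ary algebra $(V,\mu)$ with derived potential $\mu\in S^{n+1}V$ has the alternating multiplication $\{a_1,\ldots,a_n\}=[a_1,[\ldots,[a_n,\mu]\ldots]]$, $a_i\in V$. With $L=\xi_1\cdots\xi_m$, the linear map $*:S^pV\to S^{m-p}V$ is given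 by $*(x_1\cdots x_p)=[x_1,[\ldots,[x_p,L]\ldots]]$ for $x_i\in V$. A vector subspace $W\subset V$ is an ideal of an $n$-ary algebra if $\{v_1,\ldots,v_{n-1},w\}\in W$ for all $v_i\in V$, $w\in W$. The algebra is simple if it is not $1$-dimensional and has no proper ideals (no ideals other than $0$ and $V$). *)

theory Defs
  imports "HOL-Analysis.Analysis"
begin

section \<open>The exterior algebra of a real vector space\<close>

text \<open>
  The unital associative real algebra presented by the elements of the vector space, subject to
  the linear relations of the space and to \<open>x * x = 0\<close>; equivalently, the tensor
  algebra modulo the ideal generated by the squares of vectors. It is the algebra \<open>S\<^sup>*V\<close>
  of a pure odd space \<open>V\<close>.
\<close>

datatype 'a ext_term =
    Gen 'a
  | Scal real
  | Add "'a ext_term" "'a ext_term"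
  | Mul "'a ext_term" "'a ext_term"

inductive ext_eq :: "'a::real_vector ext_term \<Rightarrow> 'a ext_term \<Rightarrow> bool" where
  ext_eq_refl: "ext_eq a a"
| ext_eq_sym: "ext_eq a b \<Longrightarrow> ext_eq b a"
| ext_eq_trans: "ext_eq a b \<Longrightarrow> ext_eq b c \<Longrightarrow> ext_eq a c"
| ext_eq_cong_add: "ext_eq a a' \<Longrightarrow> ext_eq b b' \<Longrightarrow> ext_eq (Add a b) (Add a' b')"
| ext_eq_cong_mul: "ext_eq a a' \<Longrightarrow> ext_eq b b' \<Longrightarrow> ext_eq (Mul a b) (Mul a' b')"
| ext_eq_add_assoc: "ext_eq (Add (Add a b) c) (Add a (Add b c))"
| ext_eq_add_comm: "ext_eq (Add a b) (Add b a)"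
| ext_eq_add_0: "ext_eq (Add (Scal 0) a) a"
| ext_eq_mul_assoc: "ext_eq (Mul (Mul a b) c) (Mul a (Mul b c))"
| ext_eq_mul_0: "ext_eq (Mul (Scal 0) a) (Scal 0)"
| ext_eq_mul_1: "ext_eq (Mul (Scal 1) a) a"
| ext_eq_distrib_left: "ext_eq (Mul a (Add b c)) (Add (Mul a b) (Mul a c))"
| ext_eq_distrib_right: "ext_eq (Mul (Add a b) c) (Add (Mul a c) (Mul b c))"
| ext_eq_central: "ext_eq (Mul (Scal r) a) (Mul a (Scal r))"
| ext_eq_scal_add: "ext_eq (Add (Scal r) (Scal s)) (Scal (r + s))"
| ext_eq_scal_mul: "ext_eq (Mul (Scal r) (Scal s)) (Scal (r * s))"
| ext_eq_gen_add: "ext_eq (Gen (x + y)) (Add (Gen x) (Gen y))"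
| ext_eq_gen_scale: "ext_eq (Gen (r *\<^sub>R x)) (Mul (Scal r) (Gen x))"
| ext_eq_gen_square: "ext_eq (Mul (Gen x) (Gen x)) (Scal 0)"

quotient_type (overloaded) 'a ext = "'a::real_vector ext_term" / ext_eq
  by (intro equivpI reflpI sympI transpI) (rule ext_eq_refl, erule ext_eq_sym, erule (1) ext_eq_trans)

lift_definition gen :: "'a::real_vector \<Rightarrow> 'a ext" is Gen .

primrec scalar_part_term :: "'a::real_vector ext_term \<Rightarrow> real" where
  "scalar_part_term (Gen x) = 0"
| "scalar_part_term (Scal r) = r"
| "scalar_part_term (Add a b) = scalar_part_term a + scalar_part_term b"
| "scalar_part_term (Mul a b) = scalar_part_term a * scalar_part_term b"

lemma scalar_part_term_cong: "ext_eq a b \<Longrightarrow> scalar_part_term a = scalar_part_term b"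
  by (induction rule: ext_eq.induct) (auto simp: algebra_simps)

instantiation ext :: (real_vector) real_algebra_1
begin

lift_definition zero_ext :: "'a ext" is "Scal 0" .
lift_definition one_ext :: "'a ext" is "Scal 1" .
lift_definition plus_ext :: "'a ext \<Rightarrow> 'a ext \<Rightarrow> 'a ext" is Add by (rule ext_eq_cong_add)
lift_definition times_ext :: "'a ext \<Rightarrow> 'a ext \<Rightarrow> 'a ext" is Mul by (rule ext_eq_cong_mul)
lift_definition scaleR_ext :: "real \<Rightarrow> 'a ext \<Rightarrow> 'a ext" is "\<lambda>r. Mul (Scal r)"
  by (intro ext_eq_cong_mul ext_eq_refl)
lift_definition uminus_ext :: "'a ext \<Rightarrow> 'a ext" is "Mul (Scal (-1))"
  by (intro ext_eq_cong_mul ext_eq_refl)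
definition minus_ext :: "'a ext \<Rightarrow> 'a ext \<Rightarrow> 'a ext" where "minus_ext a b = a + - b"

instance
proof
  fix a b c :: "'a ext" and r s :: real
  show "a + b + c = a + (b + c)" by transfer (rule ext_eq_add_assoc)
  show "a + b = b + a" by transfer (rule ext_eq_add_comm)
  show "0 + a = a" by transfer (rule ext_eq_add_0)
  show "- a + a = 0"
  proof transfer
    fix a :: "'a ext_term"
    have "ext_eq (Add (Mul (Scal (-1)) a) a) (Add (Mul (Scal (-1)) a) (Mul (Scal 1) a))"
      by (rule ext_eq_cong_add[OF ext_eq_refl ext_eq_sym[OF ext_eq_mul_1]])
    moreover have "ext_eq \<dots> (Mul (Add (Scal (-1)) (Scal 1)) a)"
      by (rule ext_eq_sym[OF ext_eq_distrib_right])
    moreover have "ext_eq \<dots> (Mul (Scal (-1 + 1)) a)"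
      by (intro ext_eq_cong_mul ext_eq_scal_add ext_eq_refl)
    moreover have "ext_eq (Mul (Scal (-1 + 1)) a) (Scal 0)"
      by (simp add: ext_eq_mul_0)
    ultimately show "ext_eq (Add (Mul (Scal (-1)) a) a) (Scal 0)"
      by (meson ext_eq_trans)
  qed
  show "a - b = a + - b" by (rule minus_ext_def)
  show "a * b * c = a * (b * c)" by transfer (rule ext_eq_mul_assoc)
  show "1 * a = a" by transfer (rule ext_eq_mul_1)
  show "a * 1 = a"
    by transfer (rule ext_eq_trans[OF ext_eq_sym[OF ext_eq_central] ext_eq_mul_1])
  show "(a + b) * c = a * c + b * c" by transfer (rule ext_eq_distrib_right)
  show "a * (b + c) = a * b + a * c" by transfer (rule ext_eq_distrib_left)
  show "0 \<noteq> (1 :: 'a ext)" by transfer (auto dest: scalar_part_term_cong)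
  show "r *\<^sub>R (a + b) = r *\<^sub>R a + r *\<^sub>R b" by transfer (rule ext_eq_distrib_left)
  show "(r + s) *\<^sub>R a = r *\<^sub>R a + s *\<^sub>R a"
    by transfer (rule ext_eq_trans[OF ext_eq_cong_mul[OF ext_eq_sym[OF ext_eq_scal_add] ext_eq_refl] ext_eq_distrib_right])
  show "r *\<^sub>R s *\<^sub>R a = (r * s) *\<^sub>R a"
    by transfer (rule ext_eq_trans[OF ext_eq_sym[OF ext_eq_mul_assoc] ext_eq_cong_mul[OF ext_eq_scal_mul ext_eq_refl]])
  show "1 *\<^sub>R a = a" by transfer (rule ext_eq_mul_1)
  show "r *\<^sub>R a * b = r *\<^sub>R (a * b)" by transfer (rule ext_eq_mul_assoc)
  show "a * r *\<^sub>R b = r *\<^sub>R (a * b)"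
    by transfer (rule ext_eq_trans[OF ext_eq_sym[OF ext_eq_mul_assoc]
          ext_eq_trans[OF ext_eq_cong_mul[OF ext_eq_sym[OF ext_eq_central] ext_eq_refl] ext_eq_mul_assoc]])
qed

end

lemma Scal_eq_of_real: "abs_ext (Scal r) = of_real r"
  unfolding of_real_def
  by transfer (rule ext_eq_trans[OF ext_eq_sym[OF ext_eq_mul_1] ext_eq_central])

lemma ext_induct [case_names gen of_real add mult]:
  fixes a :: "'a::real_vector ext"
  assumes "\<And>x. P (gen x)" "\<And>r. P (of_real r)"
    and "\<And>a b. P a \<Longrightarrow> P b \<Longrightarrow> P (a + b)" "\<And>a b. P a \<Longrightarrow> P b \<Longrightarrow> P (a * b)"
  shows "P a"
proof (induction a rule: ext.abs_induct)
  fix t :: "'a ext_term"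
  show "P (abs_ext t)"
    by (induction t)
      (use assms in \<open>auto simp: Scal_eq_of_real gen.abs_eq[symmetric] plus_ext.abs_eq[symmetric]
         times_ext.abs_eq[symmetric]\<close>)
qed

lemma gen_add: "gen (x + y) = gen x + gen y"
  by transfer (rule ext_eq_gen_add)

lemma gen_scaleR: "gen (r *\<^sub>R x) = r *\<^sub>R gen x"
  by transfer (rule ext_eq_gen_scale)

lemma gen_square [simp]: "gen x * gen x = 0"
  by transfer (rule ext_eq_gen_square)

lemma linear_gen: "linear gen"
  by (intro linearI gen_add gen_scaleR)

lemma gen_anticomm: "gen x * gen y = - (gen y * gen x)"
proof -
  have "gen (x + y) * gen (x + y) = 0" by (rule gen_square)
  then show ?thesis
    by (simp add: gen_add algebra_simps del: gen_square)
       (simp add: eq_neg_iff_add_eq_0 add.commute)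
qed

lift_definition scalar_part :: "'a::real_vector ext \<Rightarrow> real" is scalar_part_term
  by (rule scalar_part_term_cong)

lemma scalar_part_of_real [simp]: "scalar_part (of_real r :: 'a::real_vector ext) = r"
  by (simp add: Scal_eq_of_real[symmetric] scalar_part.abs_eq)

definition ext_power :: "nat \<Rightarrow> 'a::real_vector ext set" where
  "ext_power p = span {prod_list (map gen xs) |xs. length xs = p}"


section \<open>The Poisson bracket and the star map\<close>

definition is_poisson_bracket :: "('a::euclidean_space ext \<Rightarrow> 'a ext \<Rightarrow> 'a ext) \<Rightarrow> bool" where
  "is_poisson_bracket B \<longleftrightarrow>
     bilinear B \<and>
     (\<forall>c w. B (of_real c) w = 0 \<and> B w (of_real c) = 0) \<and>
     (\<forall>x y. B (gen x) (gen y) = of_real (x \<bullet> y)) \<and>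
     (\<forall>p q. \<forall>v\<in>ext_power p. \<forall>w1\<in>ext_power q. \<forall>w2.
        B v (w1 * w2) = B v w1 * w2 + (-1) ^ (p * q) *\<^sub>R (w1 * B v w2)) \<and>
     (\<forall>p q. \<forall>v\<in>ext_power p. \<forall>w\<in>ext_power q. B v w = - ((-1) ^ (p * q) *\<^sub>R B w v))"

definition poisson_bracket :: "'a::euclidean_space ext \<Rightarrow> 'a ext \<Rightarrow> 'a ext" where
  "poisson_bracket = (THE B. is_poisson_bracket B)"

text \<open>\<open>iter_bracket [x\<^sub>1, \<dots>, x\<^sub>n] w\<close> is \<open>[x\<^sub>1, [\<dots>, [x\<^sub>n, w]\<dots>]]\<close>.\<close>

definition iter_bracket :: "'a::euclidean_space list \<Rightarrow> 'a ext \<Rightarrow> 'a ext" where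
  "iter_bracket xs w = foldr (\<lambda>x. poisson_bracket (gen x)) xs w"

definition is_star :: "'a::euclidean_space ext \<Rightarrow> ('a ext \<Rightarrow> 'a ext) \<Rightarrow> bool" where
  "is_star L f \<longleftrightarrow> linear f \<and> (\<forall>xs. f (prod_list (map gen xs)) = iter_bracket xs L)"

definition star :: "'a::euclidean_space ext \<Rightarrow> 'a ext \<Rightarrow> 'a ext" where
  "star L = (THE f. is_star L f)"


section \<open>Derived n-ary algebras\<close>

text \<open>
  For \<open>\<mu> \<in> ext_power (n + 1)\<close> and \<open>n\<close> arguments the iterated bracket lies in
  \<open>range gen\<close> (lemma \<open>gen_derived_mult\<close> below), so that \<open>inv gen\<close> merely
  reads it as a vector.
\<close>

definition derived_mult :: "'a::euclidean_space ext \<Rightarrow> 'a list \<Rightarrow> 'a" where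
  "derived_mult \<mu> as = inv gen (iter_bracket as \<mu>)"

text \<open>An n-ary multiplication is a function on lists, of which only the values on lists of
  length \<open>n\<close> matter.\<close>

definition nary_ideal :: "nat \<Rightarrow> ('a::real_vector list \<Rightarrow> 'a) \<Rightarrow> 'a set \<Rightarrow> bool" where
  "nary_ideal n f W \<longleftrightarrow>
     subspace W \<and> (\<forall>vs w. length vs + 1 = n \<and> w \<in> W \<longrightarrow> f (vs @ [w]) \<in> W)"

definition nary_simple :: "nat \<Rightarrow> ('a::real_vector list \<Rightarrow> 'a) \<Rightarrow> bool" where
  "nary_simple n f \<longleftrightarrow>
     dim (UNIV :: 'a set) \<noteq> 1 \<and> (\<forall>W. nary_ideal n f W \<longrightarrow> W = {0} \<or> W = UNIV)"

definition orthonormal_basis :: "nat \<Rightarrow> (nat \<Rightarrow> 'a::euclidean_space) \<Rightarrow> bool" where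
  "orthonormal_basis m \<xi> \<longleftrightarrow>
     (\<forall>i\<in>{1..m}. \<forall>j\<in>{1..m}. \<xi> i \<bullet> \<xi> j = (if i = j then 1 else 0)) \<and>
     span (\<xi> ` {1..m}) = UNIV"


section \<open>Well-definedness\<close>

subsection \<open>Existence and uniqueness of the Poisson bracket\<close>

primrec involution_term :: "'a::real_vector ext_term \<Rightarrow> 'a ext" where
  "involution_term (Gen x) = - gen x"
| "involution_term (Scal r) = of_real r"
| "involution_term (Add a b) = involution_term a + involution_term b"
| "involution_term (Mul a b) = involution_term a * involution_term b"

lemma involution_term_cong: "ext_eq a b \<Longrightarrow> involution_term a = involution_term b"
  by (induction rule: ext_eq.induct)
    (simp_all add: algebra_simps gen_add gen_scaleR of_real_def)

lift_definition involution :: "'a::real_vector ext \<Rightarrow> 'a ext" is involution_term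
  by (rule involution_term_cong)

lemma involution_gen [simp]: "involution (gen x) = - gen x"
  by (simp add: gen.abs_eq involution.abs_eq)

lemma involution_of_real [simp]: "involution (of_real r) = of_real r"
  by (simp add: Scal_eq_of_real[symmetric] involution.abs_eq)

lemma involution_add [simp]: "involution (a + b) = involution a + involution b"
  by (induction a rule: ext.abs_induct; induction b rule: ext.abs_induct)
    (simp add: plus_ext.abs_eq involution.abs_eq)

lemma involution_mult [simp]: "involution (a * b) = involution a * involution b"
  by (induction a rule: ext.abs_induct; induction b rule: ext.abs_induct)
    (simp add: times_ext.abs_eq involution.abs_eq)

lemma linear_involution: "linear involution"
  by (intro linearI) (simp_all add: scaleR_conv_of_real)

primrec contraction_term :: "'a::real_inner \<Rightarrow> 'a ext_term \<Rightarrow> 'a ext" where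
  "contraction_term y (Gen x) = of_real (y \<bullet> x)"
| "contraction_term y (Scal r) = 0"
| "contraction_term y (Add a b) = contraction_term y a + contraction_term y b"
| "contraction_term y (Mul a b) =
     contraction_term y a * abs_ext b + involution_term a * contraction_term y b"

lemma contraction_term_cong: "ext_eq a b \<Longrightarrow> contraction_term y a = contraction_term y b"
proof (induction rule: ext_eq.induct)
  case (ext_eq_cong_mul a a' b b')
  then have "abs_ext b = abs_ext b'" by (simp add: ext.abs_eq_iff)
  then show ?case using ext_eq_cong_mul by (simp add: involution_term_cong)
next
  case (ext_eq_gen_square x)
  then show ?case
    by (simp add: gen.abs_eq[symmetric]) (simp add: of_real_def)
next
  case (ext_eq_gen_scale r x)
  then show ?case by (simp add: of_real_def)
qed (simp_all add: algebra_simps inner_add_right gen.abs_eq[symmetric] plus_ext.abs_eq[symmetric]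
       times_ext.abs_eq[symmetric] Scal_eq_of_real, simp_all add: of_real_def)

lift_definition contraction :: "'a::real_inner \<Rightarrow> 'a ext \<Rightarrow> 'a ext" is contraction_term
  by (rule contraction_term_cong)

lemma contraction_gen [simp]: "contraction y (gen x) = of_real (y \<bullet> x)"
  by (simp add: gen.abs_eq contraction.abs_eq)

lemma contraction_of_real [simp]: "contraction y (of_real r) = 0"
  by (simp add: Scal_eq_of_real[symmetric] contraction.abs_eq)

lemma contraction_add [simp]: "contraction y (a + b) = contraction y a + contraction y b"
  by (induction a rule: ext.abs_induct; induction b rule: ext.abs_induct)
    (simp add: plus_ext.abs_eq contraction.abs_eq)

lemma contraction_mult [simp]:
  "contraction y (a * b) = contraction y a * b + involution a * contraction y b"
  by (induction a rule: ext.abs_induct; induction b rule: ext.abs_induct)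
    (simp add: times_ext.abs_eq contraction.abs_eq involution.abs_eq)

lemma linear_contraction: "linear (contraction y)"
  by (intro linearI) (simp_all add: scaleR_conv_of_real)

lemma contraction_add_left: "contraction (x + y) a = contraction x a + contraction y a"
  by (induction a rule: ext_induct) (simp_all add: inner_add_left algebra_simps)

lemma contraction_scaleR_left: "contraction (r *\<^sub>R y) a = r *\<^sub>R contraction y a"
  by (induction a rule: ext_induct) (simp_all add: algebra_simps, simp_all add: of_real_def)

lemma contraction_involution: "contraction y (involution a) = - involution (contraction y a)"
proof (induction a rule: ext_induct)
  case (gen x)
  then show ?case using linear_neg[OF linear_contraction, of y "gen x"] by simp
qed (simp_all add: linear_0[OF linear_involution, simplified] algebra_simps)

lemma involution_involution [simp]: "involution (involution a) = a"
  by (induction a rule: ext_induct) (simp_all add: linear_neg[OF linear_involution])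

lemma contraction_contraction [simp]: "contraction y (contraction y a) = 0"
  by (induction a rule: ext_induct)
    (simp_all add: linear_0[OF linear_contraction] contraction_involution)

lemma gen_mult_ext_power:
  assumes "w \<in> ext_power p"
  shows "gen x * w \<in> ext_power (Suc p)"
proof -
  have "linear (\<lambda>w. gen x * w)"
    by (intro linearI) (simp_all add: algebra_simps)
  then have "gen x * w \<in> span ((\<lambda>w. gen x * w) ` {prod_list (map gen xs) |xs. length xs = p})"
    using assms by (simp add: linear_span_image ext_power_def)
  moreover have "(\<lambda>w. gen x * w) ` {prod_list (map gen xs) |xs. length xs = p}
      \<subseteq> {prod_list (map gen xs) |xs. length xs = Suc p}"
  proof clarsimp
    fix xs :: "'a list"
    show "\<exists>ys. gen x * prod_list (map gen xs) = prod_list (map gen ys) \<and> length ys = Suc (length xs)"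
      by (rule exI[of _ "x # xs"]) simp
  qed
  ultimately show ?thesis
    unfolding ext_power_def using span_mono by blast
qed

lemma prod_in_ext_power: "prod_list (map gen xs) \<in> ext_power (length xs)"
  by (auto simp: ext_power_def intro!: span_base)

lemma gen_in_ext_power: "gen x \<in> ext_power 1"
  using prod_in_ext_power[of "[x]"] by simp

lemma ext_power_0: "ext_power 0 = range of_real"
  by (auto simp: ext_power_def span_singleton of_real_def)

lemma ext_power_1: "ext_power 1 = range gen"
proof -
  have "{prod_list (map gen xs) |xs. length xs = 1} = range (gen :: 'a \<Rightarrow> 'a ext)"
    by (auto simp: length_Suc_conv image_iff intro!: exI[of _ "[_]"])
  moreover have "subspace (range (gen :: 'a \<Rightarrow> 'a ext))"
    by (intro linear_subspace_image linear_gen subspace_UNIV)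
  ultimately show ?thesis by (simp add: ext_power_def span_eq_iff)
qed

lemma subspace_ext_power: "subspace (ext_power p)"
  by (simp add: ext_power_def)

lemma linear_eq_on_ext_power:
  assumes "linear f" "linear g" "w \<in> ext_power p"
    and "\<And>xs. length xs = p \<Longrightarrow> f (prod_list (map gen xs)) = g (prod_list (map gen xs))"
  shows "f w = g w"
  using assms(3) unfolding ext_power_def
  by (rule linear_eq_on[OF assms(1,2)]) (use assms(4) in auto)

lemma span_products: "span (range (\<lambda>xs. prod_list (map gen xs))) = (UNIV :: 'a::real_vector ext set)"
proof -
  let ?P = "range (\<lambda>xs. prod_list (map gen xs :: 'a ext list))"
  have mult: "a * b \<in> span ?P" if a: "a \<in> span ?P" and b: "b \<in> span ?P" for a b
    using a
  proof (induction a rule: span_induct_alt)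
    case base
    then show ?case by (simp add: span_zero)
  next
    case (step c x y)
    then obtain xs where x: "x = prod_list (map gen xs)" by auto
    have "x * b \<in> span ?P"
      using b
    proof (induction b rule: span_induct_alt)
      case base
      then show ?case by (simp add: span_zero)
    next
      case (step c z w)
      then obtain ys where z: "z = prod_list (map gen ys)" by auto
      have "x * z = prod_list (map gen (xs @ ys))" by (simp add: x z)
      then have "x * z \<in> span ?P" by (metis rangeI span_base)
      then show ?case using step by (simp add: distrib_left span_add span_scale)
    qed
    then show ?case using step by (simp add: distrib_right span_add span_scale)
  qed
  have "a \<in> span ?P" for a
  proof (induction a rule: ext_induct)
    case (gen x)
    have "gen x = prod_list (map gen [x])" by simp
    then show ?case by (metis rangeI span_base)
  next
    case (of_real r)
    have "(1 :: 'a ext) = prod_list (map gen [])" by simp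
    then show ?case unfolding of_real_def by (metis rangeI span_base span_scale)
  qed (auto intro: span_add mult)
  then show ?thesis by auto
qed

lemma linear_eq_ext:
  assumes "linear f" "linear g"
    and "\<And>xs. f (prod_list (map gen xs)) = g (prod_list (map gen xs))"
  shows "f = g"
proof
  fix w
  show "f w = g w"
    by (rule linear_eq_on[OF assms(1,2), of w "range (\<lambda>xs. prod_list (map gen xs))"])
      (use assms(3) span_products in auto)
qed

lemma involution_ext_power:
  assumes "w \<in> ext_power p"
  shows "involution w = (-1) ^ p *\<^sub>R w"
proof (rule linear_eq_on_ext_power[OF linear_involution _ assms])
  show "linear ((*\<^sub>R) ((-1 :: real) ^ p) :: 'a ext \<Rightarrow> 'a ext)" by (rule linear_scale_self)
next
  fix xs :: "'a list"
  assume "length xs = p"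
  then show "involution (prod_list (map gen xs)) = (-1) ^ p *\<^sub>R prod_list (map gen xs)"
  proof (induction xs arbitrary: p)
    case Nil
    then show ?case using involution_of_real[of 1] by simp
  qed auto
qed

lemma gen_commute:
  assumes "w \<in> ext_power q"
  shows "gen x * w = (-1) ^ q *\<^sub>R (w * gen x)"
proof (rule linear_eq_on_ext_power[OF _ _ assms])
  show "linear (\<lambda>w. gen x * w)" by (intro linearI) (simp_all add: algebra_simps)
  show "linear (\<lambda>w. (-1 :: real) ^ q *\<^sub>R (w * gen x))"
    by (intro linearI) (simp_all add: algebra_simps)
next
  fix xs :: "'a list"
  assume "length xs = q"
  then show "gen x * prod_list (map gen xs) = (-1) ^ q *\<^sub>R (prod_list (map gen xs) * gen x)"
  proof (induction xs arbitrary: q)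
    case (Cons y xs)
    let ?w = "prod_list (map gen xs)"
    have "gen x * (gen y * ?w) = - (gen y * (gen x * ?w))"
      by (simp only: mult.assoc[symmetric] gen_anticomm[of x y] mult_minus_left)
    also have "gen x * ?w = (-1) ^ length xs *\<^sub>R (?w * gen x)"
      by (rule Cons.IH) (rule refl)
    finally show ?case using Cons.prems by (auto simp: mult.assoc)
  qed simp
qed

lemma supercommute:
  assumes "v \<in> ext_power p" "w \<in> ext_power q"
  shows "v * w = (-1) ^ (p * q) *\<^sub>R (w * v)"
proof (rule linear_eq_on_ext_power[OF _ _ assms(1)])
  show "linear (\<lambda>v. v * w)" by (intro linearI) (simp_all add: algebra_simps)
  show "linear (\<lambda>v. (-1 :: real) ^ (p * q) *\<^sub>R (w * v))"
    by (intro linearI) (simp_all add: algebra_simps)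
next
  fix xs :: "'a list"
  assume "length xs = p"
  then show "prod_list (map gen xs) * w = (-1) ^ (p * q) *\<^sub>R (w * prod_list (map gen xs))"
  proof (induction xs arbitrary: p)
    case (Cons y xs)
    let ?v = "prod_list (map gen xs)"
    have "gen y * ?v * w = (-1) ^ (length xs * q) *\<^sub>R (gen y * w * ?v)"
      using Cons.IH[OF refl] by (simp add: mult.assoc)
    also have "gen y * w = (-1) ^ q *\<^sub>R (w * gen y)"
      by (rule gen_commute[OF assms(2)])
    finally show ?case using Cons.prems by (auto simp: mult.assoc power_add mult_ac)
  qed simp
qed

lemma contraction_ext_power:
  assumes "w \<in> ext_power (Suc p)"
  shows "contraction y w \<in> ext_power p"
proof -
  have prod: "contraction y (prod_list (map gen xs)) \<in> ext_power p" if "length xs = Suc p" for xs p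
    using that
  proof (induction xs arbitrary: p)
    case (Cons x xs)
    have "prod_list (map gen xs) \<in> ext_power p"
      using prod_in_ext_power[of xs] Cons.prems by simp
    then have 1: "of_real (y \<bullet> x) * prod_list (map gen xs) \<in> ext_power p"
      using subspace_scale[OF subspace_ext_power] by (metis scaleR_conv_of_real)
    have "gen x * contraction y (prod_list (map gen xs)) \<in> ext_power p"
    proof (cases p)
      case 0
      then show ?thesis
        using Cons.prems contraction_of_real[of y 1] subspace_0[OF subspace_ext_power] by simp
    next
      case (Suc p')
      then show ?thesis using Cons by (auto intro: gen_mult_ext_power)
    qed
    then show ?case
      using subspace_diff[OF subspace_ext_power 1] by simp
  qed simp
  have "contraction y w \<in> span (contraction y ` {prod_list (map gen xs) |xs. length xs = Suc p})"
    using assms by (simp add: linear_span_image linear_contraction ext_power_def)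
  also have "\<dots> \<subseteq> ext_power p"
    by (intro span_minimal subspace_ext_power) (auto intro: prod)
  finally show ?thesis .
qed

lemma contraction_ext_power_0: "w \<in> ext_power 0 \<Longrightarrow> contraction y w = 0"
  by (auto simp: ext_power_0)

text \<open>For \<open>v\<close> of degree \<open>p\<close> the left factor is
  \<open>(-1)\<^sup>p\<^sup>-\<^sup>1\<close> times the contraction of \<open>v\<close>, that is, the contraction
  from the right.\<close>

definition bracket_model :: "'a::euclidean_space ext \<Rightarrow> 'a ext \<Rightarrow> 'a ext" where
  "bracket_model v w = (\<Sum>b\<in>Basis. involution (contraction b v) * contraction b w)"

lemma is_poisson_bracket_model: "is_poisson_bracket bracket_model"
  unfolding is_poisson_bracket_def
proof (intro conjI allI ballI)
  show "bilinear (bracket_model :: 'a ext \<Rightarrow> _)"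
    unfolding bilinear_def bracket_model_def
    by (intro conjI allI linearI)
      (simp_all add: linear_add[OF linear_contraction] linear_scale[OF linear_contraction]
        linear_scale[OF linear_involution] algebra_simps sum.distrib scaleR_sum_right)
next
  fix c and w :: "'a ext"
  show "bracket_model (of_real c) w = 0" "bracket_model w (of_real c) = 0"
    by (simp_all add: bracket_model_def linear_0[OF linear_involution])
next
  fix x y :: 'a
  show "bracket_model (gen x) (gen y) = of_real (x \<bullet> y)"
    unfolding euclidean_inner[of x y] by (simp add: bracket_model_def inner_commute)
next
  fix p q and v w1 w2 :: "'a ext"
  assume v: "v \<in> ext_power p" and w1: "w1 \<in> ext_power q"
  have "involution (contraction b v) * (involution w1 * contraction b w2) =
      (-1) ^ (p * q) *\<^sub>R (w1 * (involution (contraction b v) * contraction b w2))" for b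
  proof (cases p)
    case 0
    then show ?thesis using v by (simp add: contraction_ext_power_0 linear_0[OF linear_involution])
  next
    case (Suc p')
    then have c: "contraction b v \<in> ext_power p'" using v by (simp add: contraction_ext_power)
    have "contraction b v * w1 = (-1) ^ (p' * q) *\<^sub>R (w1 * contraction b v)"
      by (rule supercommute[OF c w1])
    then have "contraction b v * (w1 * z) = (-1) ^ (p' * q) *\<^sub>R (w1 * (contraction b v * z))" for z
      by (simp add: mult.assoc[symmetric])
    then show ?thesis
      by (simp add: involution_ext_power[OF c] involution_ext_power[OF w1] Suc power_add)
  qed
  then show "bracket_model v (w1 * w2) =
      bracket_model v w1 * w2 + (-1) ^ (p * q) *\<^sub>R (w1 * bracket_model v w2)"
    by (simp add: bracket_model_def algebra_simps sum.distrib scaleR_sum_right sum_distrib_left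
        sum_distrib_right)
next
  fix p q and v w :: "'a ext"
  assume v: "v \<in> ext_power p" and w: "w \<in> ext_power q"
  have "involution (contraction b v) * contraction b w =
      - ((-1) ^ (p * q) *\<^sub>R (involution (contraction b w) * contraction b v))" for b
  proof (cases "p = 0 \<or> q = 0")
    case True
    then show ?thesis
      using v w by (auto simp: contraction_ext_power_0 linear_0[OF linear_involution])
  next
    case False
    then obtain p' q' where pq: "p = Suc p'" "q = Suc q'" by (metis not0_implies_Suc)
    have cv: "contraction b v \<in> ext_power p'" and cw: "contraction b w \<in> ext_power q'"
      using v w pq by (auto intro: contraction_ext_power)
    show ?thesis
      unfolding involution_ext_power[OF cv] involution_ext_power[OF cw] mult_scaleR_left
        supercommute[OF cv cw]
      by (simp add: pq power_add algebra_simps)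
  qed
  then show "bracket_model v w = - ((-1) ^ (p * q) *\<^sub>R bracket_model w v)"
    by (simp add: bracket_model_def scaleR_sum_right sum_negf)
qed

lemma is_poisson_bracketD:
  assumes "is_poisson_bracket B"
  shows "linear (B v)" "linear (\<lambda>v. B v w)"
    and "B (of_real c) w = 0" "B w (of_real c) = 0"
    and "B (gen x) (gen y) = of_real (x \<bullet> y)"
    and "v \<in> ext_power p \<Longrightarrow> w1 \<in> ext_power q \<Longrightarrow>
      B v (w1 * w2) = B v w1 * w2 + (-1) ^ (p * q) *\<^sub>R (w1 * B v w2)"
    and "v \<in> ext_power p \<Longrightarrow> w \<in> ext_power q \<Longrightarrow> B v w = - ((-1) ^ (p * q) *\<^sub>R B w v)"
  using assms unfolding is_poisson_bracket_def bilinear_def by blast+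

lemma is_poisson_bracket_unique:
  assumes B: "is_poisson_bracket B" and C: "is_poisson_bracket C"
  shows "B = C"
proof -
  have leib: "D v (gen y * w) = D v (gen y) * w + (-1) ^ p *\<^sub>R (gen y * D v w)"
    if "is_poisson_bracket D" "v \<in> ext_power p" for D and p y and v w :: "'a ext"
    using is_poisson_bracketD(6)[OF that gen_in_ext_power] by simp
  have anti: "D v (gen y) = - ((-1) ^ p *\<^sub>R D (gen y) v)"
    if "is_poisson_bracket D" "v \<in> ext_power p" for D and p y and v :: "'a ext"
    using is_poisson_bracketD(7)[OF that gen_in_ext_power] by simp
  have one: "D v 1 = 0" if "is_poisson_bracket D" for D and v :: "'a ext"
    using is_poisson_bracketD(4)[OF that, of v 1] by simp
  have eq: "B (prod_list (map gen xs)) = C (prod_list (map gen xs))"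
    if "\<And>y. B (prod_list (map gen xs)) (gen y) = C (prod_list (map gen xs)) (gen y)" for xs
  proof (rule linear_eq_ext[OF is_poisson_bracketD(1)[OF B] is_poisson_bracketD(1)[OF C]])
    fix ys
    show "B (prod_list (map gen xs)) (prod_list (map gen ys)) =
        C (prod_list (map gen xs)) (prod_list (map gen ys))"
      by (induction ys)
        (simp_all add: one[OF B] one[OF C] leib[OF B prod_in_ext_power]
          leib[OF C prod_in_ext_power] that)
  qed
  have gen: "B (gen x) = C (gen x)" for x
    using eq[of "[x]"] by (simp add: is_poisson_bracketD(5)[OF B] is_poisson_bracketD(5)[OF C])
  have "B (prod_list (map gen xs)) = C (prod_list (map gen xs))" for xs
    by (rule eq) (simp only: anti[OF B prod_in_ext_power] anti[OF C prod_in_ext_power] gen)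
  then have "(\<lambda>v. B v w) = (\<lambda>v. C v w)" for w
    by (intro linear_eq_ext is_poisson_bracketD(2) B C) simp
  then show ?thesis by (intro HOL.ext) (simp add: fun_eq_iff)
qed

lemma ex1_is_poisson_bracket: "\<exists>!B. is_poisson_bracket B"
  using is_poisson_bracket_model is_poisson_bracket_unique by blast

lemma is_poisson_bracket_poisson_bracket: "is_poisson_bracket poisson_bracket"
  unfolding poisson_bracket_def by (rule theI'[OF ex1_is_poisson_bracket])

lemma poisson_bracket_gen: "poisson_bracket (gen (x :: 'a::euclidean_space)) = contraction x"
proof -
  have "(poisson_bracket :: 'a ext \<Rightarrow> _) = bracket_model"
    by (rule is_poisson_bracket_unique[OF is_poisson_bracket_poisson_bracket is_poisson_bracket_model])
  then have "poisson_bracket (gen x) w = (\<Sum>b\<in>Basis. (x \<bullet> b) *\<^sub>R contraction b w)" for w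
    by (simp add: bracket_model_def scaleR_conv_of_real inner_commute)
  also have "\<dots> w = contraction (\<Sum>b\<in>Basis. (x \<bullet> b) *\<^sub>R b) w" for w
  proof -
    have lin: "linear (\<lambda>y. contraction y w)"
      by (intro linearI contraction_add_left contraction_scaleR_left)
    show ?thesis by (simp only: linear_sum[OF lin] linear_scale[OF lin])
  qed
  finally show ?thesis by (simp add: euclidean_representation fun_eq_iff)
qed


subsection \<open>Existence and uniqueness of the star map\<close>

primrec act_term :: "'a::real_inner ext_term \<Rightarrow> 'a ext \<Rightarrow> 'a ext" where
  "act_term (Gen x) w = contraction x w"
| "act_term (Scal r) w = r *\<^sub>R w"
| "act_term (Add a b) w = act_term a w + act_term b w"
| "act_term (Mul a b) w = act_term a (act_term b w)"

lemma linear_act_term: "linear (act_term a)"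
proof (induction a)
  case (Gen x)
  then show ?case using linear_contraction[of x] by (simp add: linear_iff)
next
  case (Mul a b)
  then show ?case by (simp add: linear_iff)
qed (simp_all add: linear_iff algebra_simps)

lemma act_term_cong: "ext_eq a b \<Longrightarrow> act_term a w = act_term b w"
  by (induction arbitrary: w rule: ext_eq.induct)
    (simp_all add: algebra_simps linear_add[OF linear_act_term] linear_scale[OF linear_act_term]
      contraction_add_left contraction_scaleR_left)

lift_definition act :: "'a::real_inner ext \<Rightarrow> 'a ext \<Rightarrow> 'a ext" is act_term
  by (rule ext) (rule act_term_cong)

lemma act_gen: "act (gen x) w = contraction x w"
  by (simp add: gen.abs_eq act.abs_eq)

lemma act_one: "act 1 w = w"
  by (simp add: one_ext.abs_eq act.abs_eq)

lemma act_add: "act (a + b) w = act a w + act b w"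
  by (induction a rule: ext.abs_induct; induction b rule: ext.abs_induct)
    (simp add: plus_ext.abs_eq act.abs_eq)

lemma act_mult: "act (a * b) w = act a (act b w)"
  by (induction a rule: ext.abs_induct; induction b rule: ext.abs_induct)
    (simp add: times_ext.abs_eq act.abs_eq)

lemma act_scaleR: "act (r *\<^sub>R a) w = r *\<^sub>R act a w"
  by (induction a rule: ext.abs_induct) (simp add: scaleR_ext.abs_eq act.abs_eq)

lemmas act_simps = act_gen act_one act_add act_mult act_scaleR

lemma iter_bracket_Nil [simp]: "iter_bracket [] w = w"
  by (simp add: iter_bracket_def)

lemma iter_bracket_Cons [simp]: "iter_bracket (x # xs) w = contraction x (iter_bracket xs w)"
  by (simp add: iter_bracket_def poisson_bracket_gen)

lemma ex1_is_star: "\<exists>!f. is_star L f"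
proof (rule ex1I)
  have "act (prod_list (map gen xs)) L = iter_bracket xs L" for xs
    by (induction xs) (simp_all add: act_simps)
  then show "is_star L (\<lambda>w. act w L)"
    by (auto simp: is_star_def act_simps intro!: linearI)
  then show "f = (\<lambda>w. act w L)" if "is_star L f" for f
    using that unfolding is_star_def by (intro linear_eq_ext) auto
qed

lemma is_star_star: "is_star L (star L)"
  unfolding star_def by (rule theI'[OF ex1_is_star])

lemma iter_bracket_ext_power:
  assumes "w \<in> ext_power (length xs + p)"
  shows "iter_bracket xs w \<in> ext_power p"
  using assms by (induction xs arbitrary: p) (auto intro: contraction_ext_power)

lemma linear_star: "linear (star L)"
  using is_star_star[of L] unfolding is_star_def by blast

lemma star_prod: "star L (prod_list (map gen xs)) = iter_bracket xs L"
  using is_star_star[of L] unfolding is_star_def by blast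

lemma star_ext_power:
  assumes "L \<in> ext_power m" "p \<le> m" "w \<in> ext_power p"
  shows "star L w \<in> ext_power (m - p)"
proof -
  have "star L w \<in> star L ` span {prod_list (map gen xs) |xs. length xs = p}"
    using assms(3) unfolding ext_power_def by (rule imageI)
  also have "\<dots> = span (star L ` {prod_list (map gen xs) |xs. length xs = p})"
    by (rule linear_span_image[OF linear_star, symmetric])
  also have "\<dots> \<subseteq> ext_power (m - p)"
  proof (rule span_minimal[OF _ subspace_ext_power], clarify)
    fix xs :: "'a list"
    assume "p = length xs"
    with assms show "star L (prod_list (map gen xs)) \<in> ext_power (m - length xs)"
      unfolding star_prod by (intro iter_bracket_ext_power) simp
  qed
  finally show ?thesis .
qed


subsection \<open>The derived multiplication takes values in the vector space\<close>

lemma inj_gen: "inj (gen :: 'a::euclidean_space \<Rightarrow> 'a ext)"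
proof (rule injI)
  fix x y :: 'a
  assume "gen x = gen y"
  then have "scalar_part (contraction b (gen x)) = scalar_part (contraction b (gen y))" for b
    by simp
  then have "b \<bullet> x = b \<bullet> y" for b
    by (simp only: contraction_gen scalar_part_of_real)
  then have "x \<bullet> b = y \<bullet> b" for b
    by (subst (1 2) inner_commute)
  then show "x = y" by (rule euclidean_eqI)
qed

lemma gen_derived_mult:
  assumes "\<mu> \<in> ext_power (n + 1)" "length as = n"
  shows "gen (derived_mult \<mu> as) = iter_bracket as \<mu>"
proof -
  have "iter_bracket as \<mu> \<in> ext_power 1"
    using assms by (intro iter_bracket_ext_power) simp
  then show ?thesis unfolding derived_mult_def ext_power_1 by (rule f_inv_into_f)
qed

end

theory Submission
  imports Defs
begin

text \<open>
  A subspace \<open>W\<close> is an ideal iff \<open>x w v = 0\<close> for all \<open>w \<in> W\<close> and \<open>x\<close> orthogonal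
  to \<open>W\<close>, because the pairing \<open>(x, {v\<^sub>1, \<dots>, w})\<close> is the top-degree coefficient of
  \<open>x v\<^sub>1 \<cdots> w v\<close>. If \<open>W\<close> is proper and nonzero, one of \<open>W\<close> and its orthogonal complement has
  dimension at least \<open>3\<close>; say the complement does. For a nonzero \<open>w \<in> W\<close> the
  trivector \<open>w v\<close> is then annihilated by a space of dimension at least \<open>4\<close>, so
  \<open>w v = 0\<close>, which forces \<open>v\<close> to be decomposable, that is, \<open>a\<^sub>2 = 0\<close>. Conversely, if
  \<open>v\<close> is a multiple of \<open>\<xi>\<^sub>1 \<xi>\<^sub>2\<close>, then \<open>\<xi>\<^sub>1 v = 0\<close> and the line through \<open>\<xi>\<^sub>1\<close> is an ideal.
\<close>

section \<open>Nondegeneracy of contractions\<close>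

lemma contraction_zero [simp]: "contraction y 0 = 0"
  by (rule linear_0[OF linear_contraction])

lemma contraction_one [simp]: "contraction y 1 = 0"
  using contraction_of_real[of y 1] by simp

lemma contraction_scaleR [simp]: "contraction y (r *\<^sub>R w) = r *\<^sub>R contraction y w"
  by (rule linear_scale[OF linear_contraction])

lemma contraction_minus [simp]: "contraction y (- w) = - contraction y w"
  by (rule linear_neg[OF linear_contraction])

lemma contraction_diff [simp]: "contraction y (v - w) = contraction y v - contraction y w"
  by (rule linear_diff[OF linear_contraction])

lemma contraction_gen_mult:
  "contraction y (gen x * w) = (y \<bullet> x) *\<^sub>R w - gen x * contraction y w"
  by (simp add: scaleR_conv_of_real)

text \<open>Polarisation of \<open>contraction_contraction\<close> at \<open>x + y\<close>.\<close>

lemma contraction_anticomm: "contraction x (contraction y w) = - contraction y (contraction x w)"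
proof -
  have "contraction (x + y) (contraction (x + y) w) = 0" by (rule contraction_contraction)
  then show ?thesis
    by (simp add: contraction_add_left eq_neg_iff_add_eq_0 add.commute del: contraction_contraction)
       (simp add: add.commute)
qed

lemma iter_bracket_append: "iter_bracket (xs @ ys) w = iter_bracket xs (iter_bracket ys w)"
  by (simp add: iter_bracket_def)

lemma iter_bracket_zero: "iter_bracket xs 0 = 0"
  by (induction xs) simp_all

lemma contraction_iter_bracket:
  "contraction x (iter_bracket xs w) = (-1) ^ length xs *\<^sub>R iter_bracket xs (contraction x w)"
  by (induction xs) (simp_all add: contraction_anticomm[of x])

text \<open>Euler's identity: the left side is the degree operator. It recovers an element of
  positive degree from its contractions.\<close>

lemma sum_gen_contraction:
  fixes w :: "'a::euclidean_space ext"
  assumes "w \<in> ext_power p"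
  shows "(\<Sum>b\<in>Basis. gen b * contraction b w) = real p *\<^sub>R w"
proof (rule linear_eq_on_ext_power[OF _ _ assms])
  show "linear (\<lambda>w :: 'a ext. \<Sum>b\<in>Basis. gen b * contraction b w)"
    by (intro linearI) (simp_all add: algebra_simps sum.distrib scaleR_sum_right)
  show "linear (\<lambda>w :: 'a ext. real p *\<^sub>R w)" by (rule linear_scale_self)
next
  fix xs :: "'a list"
  assume "length xs = p"
  then show "(\<Sum>b\<in>Basis. gen b * contraction b (prod_list (map gen xs))) =
      real p *\<^sub>R prod_list (map gen xs)"
  proof (induction xs arbitrary: p)
    case Nil
    then show ?case by simp
  next
    case (Cons x xs)
    let ?w = "prod_list (map gen xs) :: 'a ext"
    \<comment> \<open>The sign from moving \<open>gen b\<close> past \<open>gen x\<close> cancels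
      the one from contracting past \<open>gen x\<close>; the first summands add up to the expansion
      of \<open>x\<close> in the basis.\<close>
    have "gen b * contraction b (gen x * ?w) = gen ((x \<bullet> b) *\<^sub>R b) * ?w
        + gen x * (gen b * contraction b ?w)" for b
    proof -
      have "gen b * (gen x * contraction b ?w) = - (gen x * (gen b * contraction b ?w))"
        by (simp only: mult.assoc[symmetric] gen_anticomm[of b x] mult_minus_left)
      then show ?thesis
        by (simp only: contraction_gen_mult right_diff_distrib gen_scaleR inner_commute)
          simp
    qed
    then have "(\<Sum>b\<in>Basis. gen b * contraction b (gen x * ?w)) =
        gen (\<Sum>b\<in>Basis. (x \<bullet> b) *\<^sub>R b) * ?w + gen x * (\<Sum>b\<in>Basis. gen b * contraction b ?w)"
      by (simp only: sum.distrib linear_sum[OF linear_gen] sum_distrib_left sum_distrib_right)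
    also have "\<dots> = gen x * ?w + real (length xs) *\<^sub>R (gen x * ?w)"
      using Cons.IH[OF refl] by (simp add: euclidean_representation)
    finally show ?case using Cons.prems by (auto simp: algebra_simps)
  qed
qed

lemma contractions_eq_0_imp_eq_0:
  fixes w :: "'a::euclidean_space ext"
  assumes "w \<in> ext_power (Suc p)" "\<And>y. contraction y w = 0"
  shows "w = 0"
  using sum_gen_contraction[OF assms(1)] assms(2) by simp

text \<open>Nondegeneracy in the form needed for ideals: the full iterated brackets determine a
  multivector. The innermost bracket is peeled off.\<close>

lemma iter_brackets_eq_0_imp_eq_0:
  fixes w :: "'a::euclidean_space ext"
  assumes "w \<in> ext_power p" "\<And>xs. length xs = p \<Longrightarrow> iter_bracket xs w = 0"
  shows "w = 0"
  using assms
proof (induction p arbitrary: w)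
  case 0
  then show ?case using "0.prems"(2)[of "[]"] by simp
next
  case (Suc p)
  have "contraction y w = 0" for y
  proof (rule Suc.IH[OF contraction_ext_power[OF Suc.prems(1)]])
    fix xs :: "'a list"
    assume "length xs = p"
    then show "iter_bracket xs (contraction y w) = 0"
      using Suc.prems(2)[of "xs @ [y]"] by (simp add: iter_bracket_append)
  qed
  then show ?case by (rule contractions_eq_0_imp_eq_0[OF Suc.prems(1)])
qed

text \<open>A nonzero vector annihilating \<open>u\<close> is a factor of \<open>u\<close>, and a
  nonzero element of degree \<open>p\<close> has at most \<open>p\<close> independent
  factors.\<close>

lemma dim_annihilator_le:
  fixes u :: "'a::euclidean_space ext"
  assumes "u \<in> ext_power p" "u \<noteq> 0"
  shows "dim {y. gen y * u = 0} \<le> p"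
proof -
  \<comment> \<open>Stated for orthogonal families, so that deleting one vector \<open>y\<close> and
    contracting \<open>u\<close> by it reduces \<open>p\<close> by one.\<close>
  have *: "u = 0"
    if "finite S" "pairwise orthogonal S" "0 \<notin> S" "p < card S" "\<forall>y\<in>S. gen y * u = 0"
      "u \<in> ext_power p" for S :: "'a set" and u p
    using that
  proof (induction p arbitrary: S u)
    case (0 S u)
    then obtain y where y: "y \<in> S" by fastforce
    obtain c where c: "u = of_real c" using 0 by (auto simp: ext_power_0)
    have "contraction y (gen y * u) = 0" using 0 y by simp
    then have "(y \<bullet> y) *\<^sub>R u = 0" by (simp only: contraction_gen_mult c) simp
    then show ?case using y 0 by auto
  next
    case (Suc p S u)
    then obtain y where y: "y \<in> S" by fastforce
    have "contraction y u = 0"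
    proof (rule Suc.IH[of "S - {y}"])
      show "\<forall>x\<in>S - {y}. gen x * contraction y u = 0"
      proof
        fix x
        assume x: "x \<in> S - {y}"
        then have "y \<bullet> x = 0"
          using Suc.prems(2) y by (auto simp: pairwise_def orthogonal_def)
        moreover have "contraction y (gen x * u) = 0" using Suc.prems(5) x by simp
        ultimately show "gen x * contraction y u = 0" by (simp only: contraction_gen_mult) simp
      qed
    qed (use Suc.prems y in \<open>auto intro: contraction_ext_power pairwise_subset\<close>)
    \<comment> \<open>Since \<open>contraction y u = 0\<close>, only the term with the factor
      \<open>y \<bullet> y\<close> survives.\<close>
    moreover have "contraction y (gen y * u) = 0" using Suc.prems y by simp
    ultimately have "(y \<bullet> y) *\<^sub>R u = 0" by (simp only: contraction_gen_mult) simp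
    then show ?case using y Suc.prems by auto
  qed
  have "subspace {y. gen y * u = 0}"
    by (auto simp: subspace_def gen_add gen_scaleR linear_0[OF linear_gen] algebra_simps)
  then obtain B where B: "B \<subseteq> {y. gen y * u = 0}" "pairwise orthogonal B"
      "\<And>x. x \<in> B \<Longrightarrow> norm x = 1" "independent B" "card B = dim {y. gen y * u = 0}"
    by (metis orthonormal_basis_subspace)
  have "0 \<notin> B" using B(3) by force
  then have "\<not> p < card B"
    using *[of B p u] B assms by (auto dest: independent_imp_finite)
  then show ?thesis using B(5) by simp
qed


section \<open>The star map\<close>

text \<open>The exterior algebra acts on itself by contractions, and \<open>star L\<close> evaluates
  this action at \<open>L\<close>. Left multiplication inside \<open>star\<close> thus becomes
  contraction outside.\<close>

lemma star_eq_act: "star L w = act w L"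
proof -
  have "act (prod_list (map gen xs)) L = iter_bracket xs L" for xs
    by (induction xs) (simp_all add: act_simps)
  then have "is_star L (\<lambda>w. act w L)"
    by (auto simp: is_star_def act_simps intro!: linearI)
  then show ?thesis using is_star_star ex1_is_star[of L] by metis
qed

lemma contraction_star: "contraction x (star L w) = star L (gen x * w)"
  by (simp add: star_eq_act act_simps)

text \<open>The assumption expresses that \<open>L\<close> has top degree. Multiplication by
  \<open>y\<close> and contraction by \<open>x\<close> anticommute up to the scalar
  \<open>y \<bullet> x\<close>, which carries \<open>gen y\<close> past all contractions down to
  \<open>L\<close>.\<close>

lemma gen_mult_star:
  fixes L w :: "'a::euclidean_space ext"
  assumes "\<And>y. gen y * L = 0"
  shows "gen y * star L w = star L (contraction y w)"
proof -
  have "(\<lambda>w. gen y * star L w) = (\<lambda>w. star L (contraction y w))"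
  proof (rule linear_eq_ext)
    show "linear (\<lambda>w. gen y * star L w)"
      by (intro linearI) (simp_all add: linear_add[OF linear_star] linear_scale[OF linear_star] algebra_simps)
    show "linear (\<lambda>w. star L (contraction y w))"
      by (intro linearI) (simp_all add: linear_add[OF linear_star] linear_scale[OF linear_star])
  next
    fix xs
    show "gen y * star L (prod_list (map gen xs)) = star L (contraction y (prod_list (map gen xs)))"
    proof (induction xs)
      case Nil
      then show ?case
        using assms by (simp add: star_prod[of L "[]", simplified] linear_0[OF linear_star])
    next
      case (Cons x xs)
      let ?w = "prod_list (map gen xs) :: 'a ext"
      have "gen y * star L (gen x * ?w) = (y \<bullet> x) *\<^sub>R star L ?w - contraction x (gen y * star L ?w)"
        by (simp only: contraction_star[symmetric] contraction_gen_mult) (simp add: inner_commute)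
      also have "\<dots> = star L (contraction y (gen x * ?w))"
        by (simp only: Cons.IH contraction_star contraction_gen_mult linear_diff[OF linear_star]
            linear_scale[OF linear_star])
      finally show ?case by simp
    qed
  qed
  then show ?thesis by metis
qed

text \<open>Multiplying \<open>star L w = 0\<close> by \<open>gen y\<close> contracts
  \<open>w\<close> inside \<open>star\<close>, so induction descends to scalars, where
  \<open>star L\<close> is scaling of \<open>L\<close>.\<close>

lemma star_eq_0_imp_eq_0:
  fixes L w :: "'a::euclidean_space ext"
  assumes "\<And>y. gen y * L = 0" "L \<noteq> 0" "w \<in> ext_power p" "star L w = 0"
  shows "w = 0"
  using assms(3,4)
proof (induction p arbitrary: w)
  case 0
  then obtain c where c: "w = of_real c" by (auto simp: ext_power_0)
  then have "c *\<^sub>R L = 0" using 0 by (simp add: star_eq_act of_real_def act_simps)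
  then show ?case using c assms(2) by simp
next
  case (Suc p)
  have "star L (contraction y w) = 0" for y
    using gen_mult_star[OF assms(1), where w = w] Suc.prems(2) by (metis mult_zero_right)
  then have "contraction y w = 0" for y
    using Suc.IH contraction_ext_power[OF Suc.prems(1)] by blast
  then show ?case by (rule contractions_eq_0_imp_eq_0[OF Suc.prems(1)])
qed


section \<open>Orthonormal bases and the volume element\<close>

lemma gen_mult_prod_list_eq_0:
  assumes "x \<in> set xs"
  shows "gen x * prod_list (map gen xs) = 0"
  using assms
proof (induction xs)
  case (Cons y xs)
  have "gen x * (gen y * prod_list (map gen xs)) = - (gen y * (gen x * prod_list (map gen xs)))"
    by (simp only: mult.assoc[symmetric] gen_anticomm[of x y] mult_minus_left)
  moreover have "gen x * (gen x * prod_list (map gen xs)) = 0"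
    by (simp only: mult.assoc[symmetric] gen_square mult_zero_left)
  ultimately show ?case using Cons by auto
qed simp

text \<open>For a basis this gives the top-degree property of the volume element.\<close>

lemma gen_mult_prod_list_spanning:
  assumes "y \<in> span (set xs)"
  shows "gen y * prod_list (map gen xs) = 0"
  using assms
proof (induction rule: span_induct_alt)
  case base
  then show ?case by (simp add: linear_0[OF linear_gen])
next
  case (step c x y)
  then show ?case by (simp add: gen_add gen_scaleR algebra_simps gen_mult_prod_list_eq_0)
qed

lemma contraction_prod_list_eq_0:
  assumes "\<And>y. y \<in> set xs \<Longrightarrow> x \<bullet> y = 0"
  shows "contraction x (prod_list (map gen xs)) = 0"
  using assms
proof (induction xs)
  case Nil
  then show ?case by simp
qed (simp add: contraction_gen_mult)

text \<open>Contraction by the first factor strips it off up to a nonzero scalar, because the other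
  factors are orthogonal to it.\<close>

lemma prod_list_orthogonal_neq_0:
  assumes "distinct xs" "pairwise orthogonal (set xs)" "0 \<notin> set xs"
  shows "prod_list (map gen xs) \<noteq> (0 :: 'a::euclidean_space ext)"
  using assms
proof (induction xs)
  case (Cons x xs)
  let ?w = "prod_list (map gen xs) :: 'a ext"
  have "contraction x ?w = 0"
    by (rule contraction_prod_list_eq_0) (use Cons.prems in \<open>auto simp: pairwise_insert orthogonal_def\<close>)
  then have "contraction x (gen x * ?w) = (x \<bullet> x) *\<^sub>R ?w"
    by (simp only: contraction_gen_mult) simp
  moreover have "?w \<noteq> 0" using Cons by (simp add: pairwise_insert)
  ultimately have "contraction x (gen x * ?w) \<noteq> 0" using Cons.prems by simp
  then show ?case by (auto simp del: contraction_mult)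
qed simp


section \<open>Ideals\<close>

lemma star_bivector_ext_power:
  fixes L v :: "'a::euclidean_space ext"
  assumes "L \<in> ext_power m" "m > 4" "v \<in> ext_power 2"
  shows "star L v \<in> ext_power (m - 3 + 1)"
proof -
  \<comment> \<open>The degree is put in the shape \<open>n + 1\<close> with
    \<open>n = m - 3\<close> that \<open>gen_derived_mult\<close> expects.\<close>
  have "m - 2 = m - 3 + 1" using assms(2) by simp
  then show ?thesis using star_ext_power[OF assms(1) _ assms(3)] assms(2) by simp
qed

text \<open>Contraction by \<open>x\<close> kills every product ending in \<open>w\<close>, as these
  lie in \<open>W\<close>. Moved inside, it yields all full iterated brackets of
  \<open>star L (gen x * (gen w * v))\<close> up to sign, so nondegeneracy and injectivity of
  \<open>star L\<close> apply.\<close>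

lemma nary_ideal_imp_gen_mult_eq_0:
  fixes L v :: "'a::euclidean_space ext"
  assumes L: "L \<in> ext_power m" "m > 4" "\<And>y. gen y * L = 0" "L \<noteq> 0"
    and v: "v \<in> ext_power 2"
    and W: "nary_ideal (m - 3) (derived_mult (star L v)) W"
    and w: "w \<in> W" and x: "\<And>y. y \<in> W \<Longrightarrow> x \<bullet> y = 0"
  shows "gen x * (gen w * v) = 0"
proof -
  have mem: "gen x * (gen w * v) \<in> ext_power 4"
    using gen_mult_ext_power[OF gen_mult_ext_power[OF v]] by (simp add: numeral_eq_Suc)
  have "star L (gen x * (gen w * v)) = 0"
  proof (rule iter_brackets_eq_0_imp_eq_0)
    show "star L (gen x * (gen w * v)) \<in> ext_power (m - 4)"
      by (rule star_ext_power[OF L(1) _ mem]) (use L(2) in simp)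
  next
    fix vs :: "'a list"
    \<comment> \<open>Together with \<open>w\<close> these are the \<open>m - 3\<close> arguments of
      one product.\<close>
    assume len: "length vs = m - 4"
    let ?d = "derived_mult (star L v) (vs @ [w])"
    have "?d \<in> W"
      using W w len L(2) unfolding nary_ideal_def by simp
    then have "contraction x (gen ?d) = 0" using x by simp
    moreover have "gen ?d = iter_bracket (vs @ [w]) (star L v)"
      by (rule gen_derived_mult[OF star_bivector_ext_power[OF L(1,2) v]]) (use len L(2) in simp)
    ultimately have "contraction x (iter_bracket vs (star L (gen w * v))) = 0"
      by (simp add: iter_bracket_append contraction_star)
    then show "iter_bracket vs (star L (gen x * (gen w * v))) = 0"
      by (simp add: contraction_iter_bracket contraction_star)
  qed
  then show ?thesis by (rule star_eq_0_imp_eq_0[OF L(3,4) mem])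
qed

text \<open>Every product whose last argument is on the line vanishes, since contracting
  \<open>star L v\<close> by \<open>y\<close> gives \<open>star L (gen y * v) = 0\<close>.\<close>

lemma nary_ideal_span_singleton:
  fixes L v :: "'a::euclidean_space ext"
  assumes "gen y * v = 0"
  shows "nary_ideal n (derived_mult (star L v)) (span {y})"
  unfolding nary_ideal_def
proof (intro conjI allI impI)
  fix vs :: "'a list" and w :: 'a
  assume "length vs + 1 = n \<and> w \<in> span {y}"
  then obtain c where "w = c *\<^sub>R y" by (auto simp: span_singleton)
  then have "contraction w (star L v) = 0"
    using assms by (simp add: contraction_star gen_scaleR linear_0[OF linear_star])
  then have "derived_mult (star L v) (vs @ [w]) = inv gen (gen 0)"
    by (simp add: derived_mult_def iter_bracket_append iter_bracket_zero linear_0[OF linear_gen])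
  then show "derived_mult (star L v) (vs @ [w]) \<in> span {y}"
    by (simp add: inv_f_f[OF inj_gen] span_zero)
qed simp

text \<open>The element \<open>gen z * v\<close> has degree \<open>p + 1\<close> but is annihilated
  by \<open>z\<close> and \<open>U\<close>, which together span dimension at least
  \<open>p + 2\<close>.\<close>

lemma annihilated_by_subspace_imp_eq_0:
  fixes v :: "'a::euclidean_space ext"
  assumes "v \<in> ext_power p" "subspace U" "p < dim U" "z \<noteq> 0"
    and orth: "\<And>y. y \<in> U \<Longrightarrow> z \<bullet> y = 0"
    and ann: "\<And>y. y \<in> U \<Longrightarrow> gen y * (gen z * v) = 0"
  shows "gen z * v = 0"
proof (rule ccontr)
  assume "gen z * v \<noteq> 0"
  then have "dim {y. gen y * (gen z * v) = 0} \<le> Suc p"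
    by (rule dim_annihilator_le[OF gen_mult_ext_power[OF assms(1)]])
  moreover have "insert z U \<subseteq> {y. gen y * (gen z * v) = 0}"
    using ann by (auto simp: mult.assoc[symmetric])
  then have "dim (insert z U) \<le> dim {y. gen y * (gen z * v) = 0}"
    by (rule dim_subset)
  moreover have "z \<notin> U" using orth assms(4) inner_eq_zero_iff by blast
  then have "dim (insert z U) = dim U + 1"
    using assms(2) by (metis dim_insert span_eq_iff)
  ultimately show False using assms(3) by simp
qed

lemma proper_ideal_imp_annihilating_vector:
  fixes L v :: "'a::euclidean_space ext"
  assumes dim: "DIM('a) > 4"
    and L: "L \<in> ext_power DIM('a)" "\<And>y. gen y * L = 0" "L \<noteq> 0"
    and v: "v \<in> ext_power 2"
    and W: "nary_ideal (DIM('a) - 3) (derived_mult (star L v)) W" "W \<noteq> {0}" "W \<noteq> UNIV"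
  obtains z where "z \<noteq> 0" "gen z * v = 0"
proof -
  have sW: "subspace W" using W(1) by (simp add: nary_ideal_def)
  define X where "X = {x. \<forall>w\<in>W. orthogonal w x}"
  have sX: "subspace X" unfolding X_def by (rule subspace_orthogonal_to_vectors)
  have dims: "dim X + dim W = DIM('a)"
    using dim_subspace_orthogonal_to_vectors[OF sW subspace_UNIV] by (simp add: X_def)
  have "dim W < DIM('a)"
    using W(3) sW by (metis dim_eq_full dim_subset_UNIV le_neq_implies_less span_eq_iff)
  with dims have "dim X \<noteq> 0" by linarith
  then obtain x where x: "x \<in> X" "x \<noteq> 0" unfolding dim_eq_0 by blast
  obtain w where w: "w \<in> W" "w \<noteq> 0" using W(2) subspace_0[OF sW] by blast
  have orth: "x \<bullet> w = 0" if "x \<in> X" "w \<in> W" for x w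
    using that by (auto simp: X_def orthogonal_def inner_commute)
  have ann: "gen x * (gen w * v) = 0" if "x \<in> X" "w \<in> W" for x w
    by (rule nary_ideal_imp_gen_mult_eq_0[OF L(1) dim L(2,3) v W(1) that(2)]) (rule orth[OF that(1)])
  \<comment> \<open>The annihilating vector is taken from the other of the two subspaces.\<close>
  have "2 < dim X \<or> 2 < dim W" using dims dim by linarith
  then show thesis
  proof
    assume "2 < dim X"
    with v sX have "gen w * v = 0"
      by (rule annihilated_by_subspace_imp_eq_0)
        (use w orth ann in \<open>auto simp: inner_commute\<close>)
    then show thesis using that w by blast
  next
    assume "2 < dim W"
    with v sW have "gen x * v = 0"
    proof (rule annihilated_by_subspace_imp_eq_0)
      fix y
      assume "y \<in> W"
      \<comment> \<open>The relation \<open>ann\<close> is symmetric up to sign, so \<open>X\<close>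
        and \<open>W\<close> may exchange roles.\<close>
      moreover have "gen y * (gen x * v) = - (gen x * (gen y * v))"
        by (simp only: mult.assoc[symmetric] gen_anticomm[of y x] mult_minus_left)
      ultimately show "gen y * (gen x * v) = 0" using ann x by simp
    qed (use x orth in auto)
    then show thesis using that x by blast
  qed
qed

text \<open>The contractions are those of a bivector containing \<open>c\<close> times
  \<open>p q\<close> and otherwise orthogonal to \<open>p\<close> and \<open>q\<close>. Contracting
  \<open>gen y * v = 0\<close> by \<open>p\<close> and then by \<open>q\<close> yields
  \<open>c\<close> times the difference of the two sides.\<close>

lemma gen_mult_eq_0_imp_in_plane:
  fixes v :: "'a::euclidean_space ext"
  assumes "gen y * v = 0" "c \<noteq> 0" "p \<bullet> q = 0" "norm q = 1"
    and "contraction p v = c *\<^sub>R gen q" "contraction q v = - (c *\<^sub>R gen p)"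
  shows "y = (p \<bullet> y) *\<^sub>R p + (q \<bullet> y) *\<^sub>R q"
proof -
  have "contraction q (contraction p (gen y * v)) = 0" using assms(1) by simp
  moreover have "q \<bullet> q = 1" using assms(4) by (simp add: dot_square_norm)
  ultimately have "c *\<^sub>R (gen y - (p \<bullet> y) *\<^sub>R gen p - (q \<bullet> y) *\<^sub>R gen q) = 0"
    by (simp only: contraction_gen_mult assms(5,6) contraction_diff contraction_scaleR contraction_gen)
       (simp add: algebra_simps)
  then have "gen y - (p \<bullet> y) *\<^sub>R gen p - (q \<bullet> y) *\<^sub>R gen q = 0"
    using assms(2) by (simp only: scaleR_eq_0_iff simp_thms)
  then have "gen y = gen ((p \<bullet> y) *\<^sub>R p + (q \<bullet> y) *\<^sub>R q)"
    by (simp add: gen_add gen_scaleR algebra_simps)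
  then show ?thesis by (rule injD[OF inj_gen])
qed


section \<open>Bivectors in normal form\<close>

text \<open>Merges the two parities of \<open>m\<close> into one chain; only the last coefficient
  can be negative, and only for even \<open>m\<close>.\<close>

lemma normal_form_coeffs_abs_le:
  fixes a :: "nat \<Rightarrow> real"
  assumes "(m = 2 * k + 1 \<and> 0 \<le> a k \<and> (\<forall>j\<in>{1..<k}. a (j + 1) \<le> a j)) \<or>
       (m = 2 * k \<and> \<bar>a k\<bar> \<le> a (k - 1) \<and> (\<forall>j\<in>{1..<k - 1}. a (j + 1) \<le> a j))"
    and "1 \<le> j" "j < k"
  shows "\<bar>a (j + 1)\<bar> \<le> a j"
proof -
  have mono: "a l \<le> a j" if "1 \<le> j" "j \<le> l" "\<forall>i\<in>{1..<l}. a (i + 1) \<le> a i" for j l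
    using that(2,1,3)
  proof (induction j rule: inc_induct)
    case (step i)
    have "a (i + 1) \<le> a i" using step.prems step.hyps by auto
    moreover have "a l \<le> a (i + 1)" using step by simp
    ultimately show ?case by (rule order_trans[rotated])
  qed simp
  from assms(1) show ?thesis
  proof (elim disjE conjE)
    assume k: "0 \<le> a k" "\<forall>j\<in>{1..<k}. a (j + 1) \<le> a j"
    then have "0 \<le> a (j + 1)" using mono[of "j + 1" k] assms(2,3) by simp
    then show ?thesis using k assms(2,3) by simp
  next
    assume k: "\<bar>a k\<bar> \<le> a (k - 1)" "\<forall>j\<in>{1..<k - 1}. a (j + 1) \<le> a j"
    show ?thesis
    proof (cases "j = k - 1")
      case True
      then show ?thesis using k assms(2,3) by simp
    next
      case False
      \<comment> \<open>Before the last index, \<open>a (j + 1)\<close> is nonnegative because it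
        dominates \<open>\<bar>a k\<bar>\<close>.\<close>
      then have "a (k - 1) \<le> a (j + 1)" using mono[of "j + 1" "k - 1"] k assms(2,3) by simp
      moreover have "a (j + 1) \<le> a j" using k False assms(2,3) by simp
      ultimately show ?thesis using k(1) by linarith
    qed
  qed
qed

lemma abs_decreasing_eq_0:
  fixes a :: "nat \<Rightarrow> real"
  assumes "\<And>j. 1 \<le> j \<Longrightarrow> j < k \<Longrightarrow> \<bar>a (j + 1)\<bar> \<le> a j" "a i = 0" "1 \<le> i" "i \<le> j" "j \<le> k"
  shows "a j = 0"
  using assms(4,5)
proof (induction j rule: dec_induct)
  case (step j)
  then show ?case using assms(1)[of j] assms(3) by simp
qed (use assms(2) in simp)

text \<open>The planes of the summands are mutually orthogonal, so only the summand with index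
  \<open>l\<close> contributes; the minus sign comes from passing its first factor.\<close>

lemma contraction_normal_form:
  fixes \<xi> :: "nat \<Rightarrow> 'a::euclidean_space" and a :: "nat \<Rightarrow> real"
  assumes basis: "orthonormal_basis m \<xi>" and l: "l \<in> {1..k}" "2 * k \<le> m"
    and v: "v = (\<Sum>j=1..k. a j *\<^sub>R (gen (\<xi> (2 * j - 1)) * gen (\<xi> (2 * j))))"
  shows "contraction (\<xi> (2 * l - 1)) v = a l *\<^sub>R gen (\<xi> (2 * l))"
    and "contraction (\<xi> (2 * l)) v = - (a l *\<^sub>R gen (\<xi> (2 * l - 1)))"
proof -
  have on: "\<xi> i \<bullet> \<xi> j = (if i = j then 1 else 0)" if "i \<in> {1..2 * k}" "j \<in> {1..2 * k}" for i j
    using basis that l(2) unfolding orthonormal_basis_def by simp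
  have "contraction (\<xi> (2 * l - 1)) v = (\<Sum>j=1..k. if j = l then a l *\<^sub>R gen (\<xi> (2 * l)) else 0)"
    unfolding v linear_sum[OF linear_contraction]
  proof (rule sum.cong[OF refl])
    fix j assume j: "j \<in> {1..k}"
    \<comment> \<open>Positivity of the indices keeps the truncated differences odd.\<close>
    have "2 * l - 1 \<noteq> 2 * j" "2 * l - 1 = 2 * j - 1 \<longleftrightarrow> j = l"
      using j l(1) by (simp, presburger) auto
    then have "\<xi> (2 * l - 1) \<bullet> \<xi> (2 * j) = 0"
      "\<xi> (2 * l - 1) \<bullet> \<xi> (2 * j - 1) = (if j = l then 1 else 0)"
      using j l(1) by (subst on; force)+
    then show "contraction (\<xi> (2 * l - 1)) (a j *\<^sub>R (gen (\<xi> (2 * j - 1)) * gen (\<xi> (2 * j)))) =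
        (if j = l then a l *\<^sub>R gen (\<xi> (2 * l)) else 0)"
      by (simp add: contraction_gen_mult del: contraction_mult)
  qed
  then show "contraction (\<xi> (2 * l - 1)) v = a l *\<^sub>R gen (\<xi> (2 * l))"
    using l(1) by simp
  have "contraction (\<xi> (2 * l)) v =
      (\<Sum>j=1..k. if j = l then - (a l *\<^sub>R gen (\<xi> (2 * l - 1))) else 0)"
    unfolding v linear_sum[OF linear_contraction]
  proof (rule sum.cong[OF refl])
    fix j assume j: "j \<in> {1..k}"
    have "2 * l \<noteq> 2 * j - 1"
      using j l(1) by (simp, presburger)
    then have "\<xi> (2 * l) \<bullet> \<xi> (2 * j - 1) = 0"
      "\<xi> (2 * l) \<bullet> \<xi> (2 * j) = (if j = l then 1 else 0)"
      using j l(1) by (subst on; force)+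
    then show "contraction (\<xi> (2 * l)) (a j *\<^sub>R (gen (\<xi> (2 * j - 1)) * gen (\<xi> (2 * j)))) =
        (if j = l then - (a l *\<^sub>R gen (\<xi> (2 * l - 1))) else 0)"
      by (simp add: contraction_gen_mult del: contraction_mult)
  qed
  then show "contraction (\<xi> (2 * l)) v = - (a l *\<^sub>R gen (\<xi> (2 * l - 1)))"
    using l(1) by simp
qed

theorem theorem4:
  fixes \<xi> :: "nat \<Rightarrow> 'a::euclidean_space"
    and a :: "nat \<Rightarrow> real"
    and m k :: nat
    and v L :: "'a ext"
  assumes dim: "DIM('a) = m" "m > 4"
    and basis: "orthonormal_basis m \<xi>"
    and coeffs:
      "(m = 2 * k + 1 \<and> 0 \<le> a k \<and> (\<forall>j\<in>{1..<k}. a (j + 1) \<le> a j)) \<or>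
       (m = 2 * k \<and> \<bar>a k\<bar> \<le> a (k - 1) \<and> (\<forall>j\<in>{1..<k - 1}. a (j + 1) \<le> a j))"
    and v: "v = (\<Sum>j=1..k. a j *\<^sub>R (gen (\<xi> (2 * j - 1)) * gen (\<xi> (2 * j))))"
    and L: "L = prod_list (map (\<lambda>i. gen (\<xi> i)) [1..<m + 1])"
  shows "nary_simple (m - 3) (derived_mult (star L v)) \<longleftrightarrow>
           \<not> (v = 0 \<or> (a 1 \<noteq> 0 \<and> v = a 1 *\<^sub>R (gen (\<xi> 1) * gen (\<xi> 2))))"
proof -
  \<comment> \<open>There are at least two planes, so \<open>a 2\<close>, \<open>\<xi> 3\<close> and
    \<open>\<xi> 4\<close> belong to the normal form.\<close>
  have k: "2 \<le> k" "2 * k \<le> m" using coeffs dim by auto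
  have on: "\<xi> i \<bullet> \<xi> j = (if i = j then 1 else 0)" if "i \<in> {1..m}" "j \<in> {1..m}" for i j
    using basis that unfolding orthonormal_basis_def by simp
  have xi_neq_0: "\<xi> i \<noteq> 0" if "i \<in> {1..m}" for i using on[OF that that] by auto
  define xs where "xs = map \<xi> [1..<m + 1]"
  have L': "L = prod_list (map gen xs)" by (simp add: L xs_def comp_def)
  have set_xs: "set xs = \<xi> ` {1..m}" by (auto simp: xs_def)
  have "length xs = m" by (simp add: xs_def)
  then have L_mem: "L \<in> ext_power DIM('a)" using prod_in_ext_power[of xs] by (simp add: L' dim)
  have L_top: "gen y * L = 0" for y
    unfolding L' by (rule gen_mult_prod_list_spanning) (use basis set_xs in \<open>simp add: orthonormal_basis_def\<close>)
  have "inj_on \<xi> {1..m}"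
    by (rule inj_onI) (metis on zero_neq_one)
  moreover have "set [1..<m + 1] = {1..m}" by auto
  ultimately have "distinct xs" by (simp add: xs_def distinct_map)
  moreover have "pairwise orthogonal (set xs)"
    by (auto simp: set_xs pairwise_def orthogonal_def on)
  moreover have "0 \<notin> set xs" using xi_neq_0 by (auto simp: set_xs)
  ultimately have L_neq_0: "L \<noteq> 0" unfolding L' by (rule prod_list_orthogonal_neq_0)
  have "gen x * gen y \<in> ext_power 2" for x y :: 'a
    using gen_mult_ext_power[OF gen_in_ext_power, of x y] by (simp add: numeral_2_eq_2)
  then have v_mem: "v \<in> ext_power 2"
    unfolding v by (intro subspace_sum subspace_scale subspace_ext_power) auto
  note decreasing = normal_form_coeffs_abs_le[OF coeffs]
  have split: "v = a 1 *\<^sub>R (gen (\<xi> 1) * gen (\<xi> 2)) +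
      (\<Sum>j=2..k. a j *\<^sub>R (gen (\<xi> (2 * j - 1)) * gen (\<xi> (2 * j))))"
    unfolding v using k by (simp add: sum.atLeast_Suc_atMost numeral_2_eq_2)
  show ?thesis
  proof (cases "v = 0 \<or> (a 1 \<noteq> 0 \<and> v = a 1 *\<^sub>R (gen (\<xi> 1) * gen (\<xi> 2)))")
    case True
    \<comment> \<open>In both exceptional cases \<open>\<xi> 1\<close> annihilates \<open>v\<close>:
      either \<open>v\<close> is zero or \<open>\<xi> 1\<close> is a factor.\<close>
    then have "gen (\<xi> 1) * v = 0" by (auto simp: mult.assoc[symmetric])
    then have "nary_ideal (m - 3) (derived_mult (star L v)) (span {\<xi> 1})"
      by (rule nary_ideal_span_singleton)
    moreover have "span {\<xi> 1} \<noteq> {0}"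
      using xi_neq_0[of 1] dim span_base[of "\<xi> 1" "{\<xi> 1}"] by auto
    moreover have "span {\<xi> 1} \<noteq> UNIV"
    proof
      assume "span {\<xi> 1} = UNIV"
      then have "dim {\<xi> 1} = m" using dim by (metis dim_span dim_UNIV)
      then show False using dim_le_card[of "{\<xi> 1}" "{\<xi> 1}"] dim by (simp add: span_superset)
    qed
    ultimately show ?thesis using True unfolding nary_simple_def by blast
  next
    case False
    \<comment> \<open>A zero here propagates along the chain and leaves only the first summand,
      which is one of the exceptional cases whether or not \<open>a 1\<close> vanishes.\<close>
    have a2: "a 2 \<noteq> 0"
    proof
      assume "a 2 = 0"
      then have "a j = 0" if "j \<in> {2..k}" for j
        using abs_decreasing_eq_0[of k a 2 j] decreasing that by simp
      then have "v = a 1 *\<^sub>R (gen (\<xi> 1) * gen (\<xi> 2))" using split by simp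
      then show False using False by auto
    qed
    moreover have "\<bar>a 2\<bar> \<le> a 1" using decreasing[of 1] k by (simp add: numeral_2_eq_2)
    ultimately have a1: "a 1 \<noteq> 0" by auto
    have "nary_simple (m - 3) (derived_mult (star L v))"
      unfolding nary_simple_def
    proof (intro conjI allI impI)
      show "dim (UNIV :: 'a set) \<noteq> 1" using dim by simp
    next
      fix W
      assume ideal: "nary_ideal (m - 3) (derived_mult (star L v)) W"
      show "W = {0} \<or> W = UNIV"
      proof (rule ccontr)
        assume "\<not> (W = {0} \<or> W = UNIV)"
        then obtain z where z: "z \<noteq> 0" "gen z * v = 0"
          using proper_ideal_imp_annihilating_vector[of L v W] L_mem L_top L_neq_0 v_mem ideal dim
          by metis
        note c1 = contraction_normal_form[OF basis _ k(2) v, of 1, simplified]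
        note c2 = contraction_normal_form[OF basis _ k(2) v, of 2, simplified]
        have norm: "norm (\<xi> i) = 1" if "i \<in> {1..m}" for i
          using on[OF that that] by (simp add: norm_eq_1)
        \<comment> \<open>As \<open>a 1\<close> and \<open>a 2\<close> are both nonzero,
          \<open>z\<close> lies in two mutually orthogonal planes and must vanish.\<close>
        have "z = (\<xi> 1 \<bullet> z) *\<^sub>R \<xi> 1 + (\<xi> 2 \<bullet> z) *\<^sub>R \<xi> 2"
          by (rule gen_mult_eq_0_imp_in_plane[OF z(2) a1]) (use c1 k dim on norm in auto)
        then have z12: "\<xi> i \<bullet> z = 0" if "i = 3 \<or> i = 4" for i
          by (rule ssubst[where P = "\<lambda>z. \<xi> i \<bullet> z = 0"])
            (use that dim in \<open>auto simp: inner_add_right on\<close>)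
        have "z = (\<xi> 3 \<bullet> z) *\<^sub>R \<xi> 3 + (\<xi> 4 \<bullet> z) *\<^sub>R \<xi> 4"
          by (rule gen_mult_eq_0_imp_in_plane[OF z(2) a2]) (use c2 k dim on norm in auto)
        then show False using z12 z(1) by simp
      qed
    qed
    then show ?thesis using False by blast
  qed
qed

end
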